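(* There is a constant $C>0$ depending only on $d$ and $k$ such that, writing $f\asymp g$ for $C^{-1}g\le f\le Cg$, for all $x,y\in\mathbb{B}$, $$G_k(x,y)\asymp\int_{C(y)}\frac{(1-|x|^2)(1-|y|^2)\,d\mu_y(z)}{\bigl(1+|x|^2|y|^2-2\langle x,z\rangle\bigr)\bigl(|x|^2+|y|^2-2\langle x,z\rangle\bigr)^{\gamma+d/2-1}}$$ $$\asymp\int_{C(y)}\frac{\delta(x)\delta(y)\,d\mu_y(z)}{\bigl(\delta(x)\delta(y)+|x|^2+|y|^2-2\langle x,z\rangle\bigr)\bigl(|x|^2+|y|^2-2\langle x,z\rangle\bigr)^{\gamma+d/2-1}},$$ where $\delta(x)=1-|x|$ (all quantities taking values in $[0,\infty]$).
   Context: Let $R\subset\mathbb{R}^d$ be a (reduced) root system, not necessarily crystallographic and not necessarily spanning $\mathbb{R}^d$; $W$ is the finite group generated by the reflections $\sigma_\alpha$, $\alpha\in R$; $R_+$ is a positive subsystem; $k:R\to[0,\infty)$ is $W$-invariant (the root system is regarded as part of the datum $k$). Put $\gamma=\sum_{\alpha\in R_+}k(\alpha)$ and $\omega_k(x)=\prod_{\alpha\in R_+}|\langle\alpha,x\rangle|^{2k(\alpha)}$. It is assumed throughout that $d+2\gamma>2$. Dunkl operators: $T_\xi f(x)=\partial_\xi f(x)+\sum_{\alpha\in R_+}k(\alpha)\langle\alpha,\xi\rangle\frac{f(x)-f(\sigma_\alpha x)}{\langle\alpha,x\rangle}$. The intertwining operator $V_k$ is the unique linear isomorphism of the space of polynomials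 on $\mathbb{R}^d$ preserving the degree of homogeneity with $V_k(1)=1$ and $T_\xi V_k=V_k\partial_\xi$ for all $\xi$. For $x\in\mathbb{R}^d$, $C(x)$ is the convex hull of the orbit $W.x$, and $\mu_x=\mu_x^k$ is the probability measure on $C(x)$ with $V_kf(x)=\int_{C(x)}f\,d\mu_x$ for all polynomials $f$. $\mathbb{B}=\{|x|<1\}$, $\mathbb{S}=\partial\mathbb{B}$, $\sigma$ is the surface measure on $\mathbb{S}$, $d_k=\int_{\mathbb{S}}\omega_k\,d\sigma$, $C_k=\frac{1}{d_k(d+2\gamma-2)}$. The Green function of $\mathbb{B}$ for the Dunkl Laplacian $\Delta_k=\sum_i T_{e_i}^2$ is given by $$G_k(x,y)=C_k\int_{C(y)}\Bigl[(|x|^2+|y|^2-2\langle x,z\rangle)^{1-\gamma-d/2}-(1+|x|^2|y|^2-2\langle x,z\rangle)^{1-\gamma-d/2}\Bigr]d\mu_y(z).$$ *)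

theory Defs
  imports "HOL-Analysis.Analysis"
begin

section \<open>Root systems\<close>

definition root_reflection :: "'a::euclidean_space \<Rightarrow> 'a \<Rightarrow> 'a" where
  "root_reflection \<alpha> x = x - (2 * (\<alpha> \<bullet> x) / (\<alpha> \<bullet> \<alpha>)) *\<^sub>R \<alpha>"

text \<open>Reduced, but neither crystallographic nor spanning; roots may have arbitrary lengths, and
  the empty root system (no reflections, classical Laplacian) is allowed.\<close>

definition root_system :: "'a::euclidean_space set \<Rightarrow> bool" where
  "root_system R \<longleftrightarrow> finite R \<and> 0 \<notin> R \<and>
     (\<forall>\<alpha>\<in>R. R \<inter> range (\<lambda>c. c *\<^sub>R \<alpha>) = {\<alpha>, - \<alpha>}) \<and>
     (\<forall>\<alpha>\<in>R. root_reflection \<alpha> ` R = R)"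

definition positive_subsystem :: "'a::euclidean_space set \<Rightarrow> 'a set \<Rightarrow> bool" where
  "positive_subsystem R Rp \<longleftrightarrow>
     (\<exists>u. (\<forall>\<alpha>\<in>R. \<alpha> \<bullet> u \<noteq> 0) \<and> Rp = {\<alpha>\<in>R. 0 < \<alpha> \<bullet> u})"

text \<open>The generators are involutions, so closure under composition with generators already
  gives the generated group.\<close>

inductive_set reflection_group :: "'a::euclidean_space set \<Rightarrow> ('a \<Rightarrow> 'a) set"
  for R :: "'a set" where
    one: "id \<in> reflection_group R"
  | step: "w \<in> reflection_group R \<Longrightarrow> \<alpha> \<in> R \<Longrightarrow> root_reflection \<alpha> \<circ> w \<in> reflection_group R"

definition multiplicity_function :: "'a::euclidean_space set \<Rightarrow> ('a \<Rightarrow> real) \<Rightarrow> bool" where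
  "multiplicity_function R k \<longleftrightarrow> (\<forall>\<alpha>\<in>R. 0 \<le> k \<alpha>) \<and>
     (\<forall>w\<in>reflection_group R. \<forall>\<alpha>\<in>R. k (w \<alpha>) = k \<alpha>)"

definition orbit_hull :: "'a::euclidean_space set \<Rightarrow> 'a \<Rightarrow> 'a set" where
  "orbit_hull R x = convex hull ((\<lambda>w. w x) ` reflection_group R)"

definition gamma_k :: "'a::euclidean_space set \<Rightarrow> ('a \<Rightarrow> real) \<Rightarrow> real" where
  "gamma_k Rp k = (\<Sum>\<alpha>\<in>Rp. k \<alpha>)"

text \<open>The case distinction implements the convention \<open>0\<^sup>0 = 1\<close>; Isabelle has \<open>0 powr 0 = 0\<close>.\<close>

definition omega_k :: "'a::euclidean_space set \<Rightarrow> ('a \<Rightarrow> real) \<Rightarrow> 'a \<Rightarrow> real" where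
  "omega_k Rp k x =
     (\<Prod>\<alpha>\<in>Rp. if k \<alpha> = 0 then 1 else \<bar>\<alpha> \<bullet> x\<bar> powr (2 * k \<alpha>))"

section \<open>Dunkl operators, the intertwining operator and its representing measures\<close>

text \<open>On the hyperplane orthogonal to \<open>\<alpha>\<close> the difference quotient is read as its
  continuous extension: since \<open>\<sigma>\<^sub>\<alpha> x = x - (2 \<langle>\<alpha>,x\<rangle> / |\<alpha>|\<^sup>2) \<alpha>\<close>, its limit there
  is \<open>(2 / |\<alpha>|\<^sup>2) \<partial>\<^sub>\<alpha> f\<close> (for continuously differentiable \<open>f\<close>).\<close>

definition reflection_quotient :: "'a::euclidean_space \<Rightarrow> ('a \<Rightarrow> real) \<Rightarrow> 'a \<Rightarrow> real" where
  "reflection_quotient \<alpha> f x =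
     (if \<alpha> \<bullet> x = 0 then 2 / (\<alpha> \<bullet> \<alpha>) * frechet_derivative f (at x) \<alpha>
      else (f x - f (root_reflection \<alpha> x)) / (\<alpha> \<bullet> x))"

definition dunkl_op ::
    "'a::euclidean_space set \<Rightarrow> ('a \<Rightarrow> real) \<Rightarrow> 'a \<Rightarrow> ('a \<Rightarrow> real) \<Rightarrow> 'a \<Rightarrow> real" where
  "dunkl_op Rp k \<xi> f x =
     frechet_derivative f (at x) \<xi> +
     (\<Sum>\<alpha>\<in>Rp. k \<alpha> * (\<alpha> \<bullet> \<xi>) * reflection_quotient \<alpha> f x)"

definition homogeneous_polynomial :: "nat \<Rightarrow> ('a::euclidean_space \<Rightarrow> real) \<Rightarrow> bool" where
  "homogeneous_polynomial n p \<longleftrightarrow>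
     real_polynomial_function p \<and> (\<forall>c x. p (c *\<^sub>R x) = c ^ n * p x)"

text \<open>Only the restriction of \<open>V\<close> to polynomial functions is constrained. That restriction is
  uniquely determined.\<close>

definition intertwining_operator ::
    "'a::euclidean_space set \<Rightarrow> ('a \<Rightarrow> real) \<Rightarrow> (('a \<Rightarrow> real) \<Rightarrow> 'a \<Rightarrow> real) \<Rightarrow> bool" where
  "intertwining_operator Rp k V \<longleftrightarrow>
     bij_betw V {p. real_polynomial_function p} {p. real_polynomial_function p} \<and>
     (\<forall>p q. real_polynomial_function p \<longrightarrow> real_polynomial_function q \<longrightarrow>
        V (\<lambda>x. p x + q x) = (\<lambda>x. V p x + V q x)) \<and>
     (\<forall>c p. real_polynomial_function p \<longrightarrow> V (\<lambda>x. c * p x) = (\<lambda>x. c * V p x)) \<and>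
     (\<forall>n p. homogeneous_polynomial n p \<longrightarrow> homogeneous_polynomial n (V p)) \<and>
     V (\<lambda>x. 1) = (\<lambda>x. 1) \<and>
     (\<forall>\<xi> p. real_polynomial_function p \<longrightarrow>
        dunkl_op Rp k \<xi> (V p) = V (\<lambda>x. frechet_derivative p (at x) \<xi>))"

text \<open>Probability measures on \<open>C(x)\<close> are rendered as Borel probability measures on the whole
  space that give \<open>C(x)\<close> full mass.\<close>

definition representing_measures ::
    "'a::euclidean_space set \<Rightarrow> (('a \<Rightarrow> real) \<Rightarrow> 'a \<Rightarrow> real) \<Rightarrow> ('a \<Rightarrow> 'a measure) \<Rightarrow> bool" where
  "representing_measures R V \<mu> \<longleftrightarrow>
     (\<forall>x. sets (\<mu> x) = sets borel \<and>
          emeasure (\<mu> x) UNIV = 1 \<and> emeasure (\<mu> x) (orbit_hull R x) = 1 \<and>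
          (\<forall>p. real_polynomial_function p \<longrightarrow> V p x = (LINT z:orbit_hull R x|\<mu> x. p z)))"

section \<open>The Green function of the unit ball\<close>

text \<open>Surface measure on the unit sphere in polar-coordinate form:
  \<open>\<sigma>(A) = d \<cdot> Leb {x. 0 < |x| < 1 \<and> x/|x| \<in> A}\<close>. It is a Borel measure on the whole space,
  concentrated on the sphere; for \<open>d = 1\<close> it is counting measure on \<open>{-1, 1}\<close>.\<close>

definition sphere_measure :: "'a::euclidean_space measure" where
  "sphere_measure = scale_measure (of_nat DIM('a))
     (distr (restrict_space lborel (ball 0 1 - {0})) borel sgn)"

definition d_k :: "'a::euclidean_space set \<Rightarrow> ('a \<Rightarrow> real) \<Rightarrow> real" where
  "d_k Rp k = (LINT x:sphere 0 1|sphere_measure. omega_k Rp k x)"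

definition C_k :: "'a::euclidean_space set \<Rightarrow> ('a \<Rightarrow> real) \<Rightarrow> real" where
  "C_k Rp k = 1 / (d_k Rp k * (real DIM('a) + 2 * gamma_k Rp k - 2))"

text \<open>Powers of nonnegative reals with values in \<open>[0,\<infinity>]\<close>, where \<open>0\<^sup>s = \<infinity>\<close> for \<open>s < 0\<close>.\<close>

definition epowr :: "real \<Rightarrow> real \<Rightarrow> ennreal" where
  "epowr t s = (if t = 0 \<and> s < 0 then \<infinity> else ennreal (t powr s))"

text \<open>The truncated subtraction of \<open>ennreal\<close> is the ordinary one here: for \<open>x\<close>, \<open>y\<close> in the open
  unit ball and \<open>z \<in> C(y)\<close> the subtrahend is finite and at most the minuend, because
  \<open>1 + |x|\<^sup>2|y|\<^sup>2 - 2\<langle>x,z\<rangle> = (|x|\<^sup>2 + |y|\<^sup>2 - 2\<langle>x,z\<rangle>) + (1 - |x|\<^sup>2)(1 - |y|\<^sup>2)\<close>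
  and the exponent is negative.\<close>

definition green_k ::
    "'a::euclidean_space set \<Rightarrow> 'a set \<Rightarrow> ('a \<Rightarrow> real) \<Rightarrow> ('a \<Rightarrow> 'a measure) \<Rightarrow> 'a \<Rightarrow> 'a \<Rightarrow> ennreal" where
  "green_k R Rp k \<mu> x y =
     ennreal (C_k Rp k) *
     (\<integral>\<^sup>+z\<in>orbit_hull R y.
        (epowr ((norm x)\<^sup>2 + (norm y)\<^sup>2 - 2 * (x \<bullet> z)) (1 - gamma_k Rp k - real DIM('a) / 2) -
         epowr (1 + (norm x)\<^sup>2 * (norm y)\<^sup>2 - 2 * (x \<bullet> z)) (1 - gamma_k Rp k - real DIM('a) / 2))
      \<partial>\<mu> y)"

definition comparable :: "real \<Rightarrow> ennreal \<Rightarrow> ennreal \<Rightarrow> bool" where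
  "comparable C f g \<longleftrightarrow> ennreal (inverse C) * g \<le> f \<and> f \<le> ennreal C * g"

end

theory Submission
  imports Defs
begin

text \<open>
  The two comparisons already hold between the integrands, for every \<open>z \<in> C(y)\<close> separately;
  integrating them against \<open>\<mu>\<^sub>y\<close> gives the theorem.

  Fix \<open>x\<close>, \<open>y\<close> in the ball and \<open>z \<in> C(y)\<close>, and put \<open>s = \<gamma> + d/2 - 1 > 0\<close>,
  \<open>a = |x|\<^sup>2 + |y|\<^sup>2 - 2\<langle>x,z\<rangle>\<close> and \<open>P = (1 - |x|\<^sup>2)(1 - |y|\<^sup>2) > 0\<close>. Reflections are isometries,
  so \<open>|z| \<le> |y|\<close> and \<open>a \<ge> (|x| - |y|)\<^sup>2 \<ge> 0\<close>, while
  \<open>1 + |x|\<^sup>2|y|\<^sup>2 - 2\<langle>x,z\<rangle> = a + P\<close>. Hence everything depends on \<open>a\<close> and \<open>P\<close> only.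

  For the Green function, \<open>a\<^sup>-\<^sup>s - (a + P)\<^sup>-\<^sup>s = a\<^sup>-\<^sup>s (1 - t\<^sup>s)\<close> with \<open>t = a / (a + P) \<in> [0,1]\<close>, and
  \<open>1 - t\<^sup>s\<close> is comparable to \<open>1 - t = P / (a + P)\<close> with constants \<open>min 1 s\<close> and \<open>max 1 s\<close>
  (\<open>one_minus_powr_bounds\<close>, \<open>epowr_difference_bounds\<close>). When \<open>a = 0\<close>, both sides are infinite.
  The second comparison replaces \<open>P\<close> by \<open>D = \<delta>(x)\<delta>(y)\<close>: since \<open>D \<le> P \<le> 4D\<close> and \<open>q / (q + a)\<close> is
  increasing in \<open>q\<close>, it costs at most a factor \<open>4\<close> (\<open>kernel_bounds\<close>).

  The prefactor \<open>C\<^sub>k\<close> has to be a positive finite number, which amounts to \<open>d\<^sub>k > 0\<close>: the weight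
  \<open>\<omega>\<^sub>k\<close> is bounded on the sphere and vanishes only on finitely many hyperplanes
  (\<open>d_k_pos\<close>). The constants may depend on \<open>R\<^sub>+\<close>, but a finite root system has only finitely many
  positive subsystems, so one may take the largest.
\<close>

section \<open>Elementary inequalities behind the kernel estimates\<close>

text \<open>The weighted arithmetic-geometric mean inequality, applied to \<open>t\<close> and \<open>1\<close>.\<close>

lemma powr_le_affine:
  fixes t s :: real
  assumes "0 < t" "0 < s" "s \<le> 1"
  shows "t powr s \<le> 1 + s * (t - 1)"
proof (cases "s = 1")
  case True
  then show ?thesis using assms by simp
next
  case False
  then show ?thesis
    using Youngs_inequality_0[of s "1 - s" t 1] assms by (simp add: algebra_simps)
qed

text \<open>By concavity or convexity \<open>t\<^sup>s\<close> lies between \<open>t\<close> and its tangent line at \<open>1\<close>. For \<open>s \<ge> 1\<close>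
  the tangent bound follows from the case \<open>1 / s\<close> applied to \<open>t\<^sup>s\<close>.\<close>

lemma one_minus_powr_bounds:
  fixes t s :: real
  assumes "0 < t" "t \<le> 1" "0 < s"
  shows "min 1 s * (1 - t) \<le> 1 - t powr s" and "1 - t powr s \<le> max 1 s * (1 - t)"
proof -
  have "min 1 s * (1 - t) \<le> 1 - t powr s \<and> 1 - t powr s \<le> max 1 s * (1 - t)"
  proof (cases "s \<le> 1")
    case True
    have "t powr 1 \<le> t powr s"
      using assms True by (intro powr_mono') auto
    then show ?thesis
      using powr_le_affine[of t s] assms True by (simp add: min_def max_def algebra_simps)
  next
    case False
    have "t powr s \<le> t powr 1"
      using assms False by (intro powr_mono') auto
    moreover have "(t powr s) powr (1 / s) \<le> 1 + (1 / s) * (t powr s - 1)"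
      using assms False by (intro powr_le_affine) auto
    then have "t \<le> 1 + (1 / s) * (t powr s - 1)"
      using assms by (simp add: powr_powr)
    then have "s * t \<le> s * (1 + (1 / s) * (t powr s - 1))"
      using assms by (intro mult_left_mono) auto
    then have "s * t \<le> s + (t powr s - 1)"
      using assms by (simp add: algebra_simps)
    ultimately show ?thesis
      using assms False by (simp add: min_def max_def algebra_simps)
  qed
  then show "min 1 s * (1 - t) \<le> 1 - t powr s" "1 - t powr s \<le> max 1 s * (1 - t)"
    by auto
qed

text \<open>At \<open>a = 0\<close> both the difference and the quotient are \<open>\<infinity>\<close>, so the comparison
  survives on the diagonal.\<close>

lemma epowr_difference_bounds:
  fixes a P s :: real
  assumes a: "0 \<le> a" and P: "0 < P" and s: "0 < s"
  shows "ennreal (min 1 s) * (ennreal P / ennreal ((a + P) * a powr s))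
           \<le> epowr a (- s) - epowr (a + P) (- s)"
    and "epowr a (- s) - epowr (a + P) (- s)
           \<le> ennreal (max 1 s) * (ennreal P / ennreal ((a + P) * a powr s))"
proof -
  define b where "b = a + P"
  have b: "0 < b" using a P by (simp add: b_def)
  define F where "F = ennreal P / ennreal ((a + P) * a powr s)"
  define E where "E = epowr a (- s) - epowr (a + P) (- s)"
  have "ennreal (min 1 s) * F \<le> E \<and> E \<le> ennreal (max 1 s) * F"
  proof (cases "a = 0")
    case True
    have "E = \<infinity>"
      using True P s by (simp add: E_def epowr_def)
    moreover have "F = \<infinity>"
      using True P by (simp add: F_def)
    ultimately show ?thesis
      using s by (simp add: ennreal_mult_top)
  next
    case False
    then have a0: "0 < a" using a by simp
    define t where "t = a / b"
    have t: "0 < t" "t \<le> 1"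
      using a0 b P by (auto simp: t_def b_def)
    have le: "b powr (- s) \<le> a powr (- s)"
      using a0 P s by (intro powr_mono2') (auto simp: b_def)
    have F_eq: "F = ennreal (a powr (- s) * (1 - t))"
    proof -
      have "P / (b * a powr s) = a powr (- s) * (1 - t)"
        using a0 b by (simp add: t_def powr_minus field_simps b_def)
      then show ?thesis
        using a0 b P by (simp add: F_def divide_ennreal flip: b_def)
    qed
    have "a powr (- s) - b powr (- s) = a powr (- s) * (1 - t powr s)"
      using a0 b by (simp add: t_def powr_minus powr_divide field_simps)
    then have E_eq: "E = ennreal (a powr (- s) * (1 - t powr s))"
      using a0 b s by (simp add: E_def epowr_def ennreal_minus flip: b_def)
    have "a powr (- s) * (min 1 s * (1 - t)) \<le> a powr (- s) * (1 - t powr s)"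
      using one_minus_powr_bounds(1)[OF t s] by (intro mult_left_mono) auto
    moreover have "a powr (- s) * (1 - t powr s) \<le> a powr (- s) * (max 1 s * (1 - t))"
      using one_minus_powr_bounds(2)[OF t s] by (intro mult_left_mono) auto
    ultimately show ?thesis
      using s t unfolding F_eq E_eq
      by (auto simp flip: ennreal_mult' intro!: ennreal_leI simp: mult.left_commute)
  qed
  then show "ennreal (min 1 s) * (ennreal P / ennreal ((a + P) * a powr s))
           \<le> epowr a (- s) - epowr (a + P) (- s)"
    and "epowr a (- s) - epowr (a + P) (- s)
           \<le> ennreal (max 1 s) * (ennreal P / ennreal ((a + P) * a powr s))"
    by (auto simp: E_def F_def)
qed

text \<open>\<open>q / (q + a)\<close> is increasing in \<open>q\<close>, and multiplying \<open>q\<close> by \<open>c \<ge> 1\<close> raises it by at most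
  the factor \<open>c\<close>.\<close>

lemma kernel_bounds:
  fixes a P D c s :: real
  assumes a: "0 \<le> a" and D: "0 < D" and DP: "D \<le> P" and Pc: "P \<le> c * D"
  shows "ennreal D / ennreal ((D + a) * a powr s) \<le> ennreal P / ennreal ((a + P) * a powr s)"
    and "ennreal P / ennreal ((a + P) * a powr s)
           \<le> ennreal c * (ennreal D / ennreal ((D + a) * a powr s))"
proof -
  have P: "0 < P" using D DP by simp
  have c: "0 < c" using P Pc D by (metis less_le_trans mult.commute zero_less_mult_pos)
  have "ennreal D / ennreal ((D + a) * a powr s) \<le> ennreal P / ennreal ((a + P) * a powr s) \<and>
    ennreal P / ennreal ((a + P) * a powr s)
      \<le> ennreal c * (ennreal D / ennreal ((D + a) * a powr s))"
  proof (cases "a = 0")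
    case True
    then show ?thesis using D P c by (simp add: ennreal_mult_top)
  next
    case False
    then have a0: "0 < a" using a by simp
    have "D * a \<le> P * a"
      using DP a0 by (intro mult_right_mono) auto
    then have "D / (D + a) \<le> P / (a + P)"
      using a0 D P by (simp add: field_simps)
    then have low: "D / (D + a) / a powr s \<le> P / (a + P) / a powr s"
      by (intro divide_right_mono) auto
    have "1 * D \<le> c * D" using DP Pc by simp
    then have "1 \<le> c" using D by (rule mult_right_le_imp_le)
    then have "P * D \<le> c * D * P" "P * a \<le> c * D * a"
      using mult_right_mono[OF Pc, of a] mult_right_mono[of 1 c "P * D"] a0 D P
      by (auto simp: mult_ac)
    then have "P * (D + a) \<le> c * D * (a + P)"
      unfolding distrib_left by linarith
    then have "P / (a + P) \<le> c * D / (D + a)"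
      using a0 D P by (simp add: pos_divide_le_eq pos_le_divide_eq)
    then have "P / (a + P) \<le> c * (D / (D + a))"
      by simp
    then have "P / (a + P) / a powr s \<le> c * (D / (D + a)) / a powr s"
      by (intro divide_right_mono) auto
    with low show ?thesis
      using a0 D P c
      by (auto simp: divide_ennreal simp flip: ennreal_mult' intro!: ennreal_leI)
  qed
  then show "ennreal D / ennreal ((D + a) * a powr s) \<le> ennreal P / ennreal ((a + P) * a powr s)"
    and "ennreal P / ennreal ((a + P) * a powr s)
           \<le> ennreal c * (ennreal D / ennreal ((D + a) * a powr s))"
    by auto
qed

section \<open>Orbits of the reflection group\<close>

lemma norm_root_reflection: "norm (root_reflection \<alpha> x) = norm x"
proof (cases "\<alpha> = 0")
  case True
  then show ?thesis by (simp add: root_reflection_def)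
next
  case False
  then have "root_reflection \<alpha> x \<bullet> root_reflection \<alpha> x = x \<bullet> x"
    by (simp add: root_reflection_def inner_diff_left inner_diff_right inner_commute field_simps)
  then show ?thesis by (simp add: norm_eq_sqrt_inner)
qed

lemma norm_reflection_group:
  assumes "w \<in> reflection_group R"
  shows "norm (w x) = norm x"
  using assms by induction (auto simp: norm_root_reflection)

lemma norm_le_of_orbit_hull:
  assumes "z \<in> orbit_hull R y"
  shows "norm z \<le> norm y"
proof -
  have "orbit_hull R y \<subseteq> cball 0 (norm y)"
    unfolding orbit_hull_def
    by (rule hull_minimal) (auto simp: norm_reflection_group)
  with assms show ?thesis by auto
qed

lemma orbit_hull_dist_nonneg:
  assumes "z \<in> orbit_hull R y"
  shows "0 \<le> (norm x)\<^sup>2 + (norm y)\<^sup>2 - 2 * (x \<bullet> z)"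
proof -
  have "x \<bullet> z \<le> norm x * norm z"
    by (rule norm_cauchy_schwarz)
  also have "\<dots> \<le> norm x * norm y"
    using norm_le_of_orbit_hull[OF assms] by (intro mult_left_mono) auto
  also have "2 * (norm x * norm y) \<le> (norm x)\<^sup>2 + (norm y)\<^sup>2"
    using sum_squares_bound[of "norm x" "norm y"] by simp
  finally show ?thesis
    using \<open>x \<bullet> z \<le> norm x * norm z\<close> by linarith
qed

section \<open>Positivity of the normalising constant\<close>

lemma omega_k_nonneg: "0 \<le> omega_k Rp k x"
  unfolding omega_k_def by (intro prod_nonneg) auto

lemma omega_k_measurable: "omega_k Rp k \<in> borel_measurable borel"
  unfolding omega_k_def by measurable

lemma omega_k_le:
  assumes "\<forall>\<alpha>\<in>Rp. 0 \<le> k \<alpha>" "norm x \<le> 1"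
  shows "omega_k Rp k x \<le> (\<Prod>\<alpha>\<in>Rp. if k \<alpha> = 0 then 1 else norm \<alpha> powr (2 * k \<alpha>))"
proof -
  have "\<bar>\<alpha> \<bullet> x\<bar> \<le> norm \<alpha>" for \<alpha>
    using Cauchy_Schwarz_ineq2[of \<alpha> x] mult_left_mono[OF assms(2), of "norm \<alpha>"] by simp
  then show ?thesis
    unfolding omega_k_def using assms(1) by (intro prod_mono) (auto intro!: powr_mono2)
qed

lemma emeasure_sphere_measure:
  fixes A :: "'a::euclidean_space set"
  assumes [measurable]: "A \<in> sets borel"
  shows "emeasure sphere_measure A =
    of_nat DIM('a) * emeasure lborel ({x. sgn x \<in> A} \<inter> (ball 0 1 - {0}))"
proof -
  have m: "sgn \<in> restrict_space lborel (ball 0 1 - {0::'a}) \<rightarrow>\<^sub>M borel"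
    by (intro measurable_restrict_space1) simp
  have "sgn -` A \<inter> space (restrict_space lborel (ball 0 1 - {0::'a})) =
      {x. sgn x \<in> A} \<inter> (ball 0 1 - {0})"
    by (auto simp: space_restrict_space)
  then show ?thesis
    unfolding sphere_measure_def
    by (simp add: emeasure_distr[OF m] emeasure_restrict_space)
qed

lemma AE_omega_k_sgn_pos:
  assumes "finite Rp" "0 \<notin> Rp"
  shows "AE x in lborel. x \<noteq> 0 \<longrightarrow> 0 < omega_k Rp k (sgn x)"
proof -
  have "AE x in lborel. \<forall>\<alpha>\<in>Rp. \<alpha> \<bullet> x \<noteq> 0"
  proof (rule AE_finite_allI[OF assms(1)])
    fix \<alpha> assume "\<alpha> \<in> Rp"
    then have "{x. \<alpha> \<bullet> x = 0} \<in> null_sets lebesgue"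
      using negligible_hyperplane[of \<alpha> 0] assms(2) by (auto simp: negligible_iff_null_sets)
    then have "AE x in lebesgue. \<alpha> \<bullet> x \<noteq> 0"
      by (rule AE_I') auto
    then show "AE x in lborel. \<alpha> \<bullet> x \<noteq> 0"
      by (simp add: AE_completion_iff)
  qed
  then show ?thesis
  proof eventually_elim
    case (elim x)
    then show ?case
      by (auto simp: omega_k_def sgn_div_norm intro!: prod_pos)
  qed
qed

text \<open>The integral of a bounded nonnegative function over a finite measure can vanish only if the
  function vanishes almost everywhere; in polar coordinates that would make \<open>\<omega>\<^sub>k\<close> vanish
  on almost the whole unit ball. Boundedness matters as well: an integral that diverges
  is \<open>0\<close> by convention.\<close>

lemma d_k_pos:
  fixes Rp :: "'a::euclidean_space set"
  assumes fin: "finite Rp" and nz: "0 \<notin> Rp" and k: "\<forall>\<alpha>\<in>Rp. 0 \<le> k \<alpha>"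
  shows "0 < d_k Rp k"
proof -
  define f where "f x = indicator (sphere 0 1) x *\<^sub>R omega_k Rp k x" for x
  have sets_sm [measurable_cong]: "sets (sphere_measure :: 'a measure) = sets borel"
    by (simp add: sphere_measure_def)
  have [measurable]: "f \<in> borel_measurable borel"
    unfolding f_def
    by (intro borel_measurable_scaleR borel_measurable_indicator omega_k_measurable) simp
  have f_nonneg: "0 \<le> f x" for x
    by (simp add: f_def omega_k_nonneg)
  have "emeasure lborel ({x. sgn x \<in> space (sphere_measure :: 'a measure)} \<inter> (ball 0 1 - {0}))
      \<le> emeasure lborel (ball (0::'a) 1)"
    by (intro emeasure_mono) auto
  also have "\<dots> < \<infinity>"
    using emeasure_lborel_ball_finite by (simp add: less_top)
  finally have "emeasure (sphere_measure :: 'a measure) (space sphere_measure) \<noteq> \<infinity>"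
    using sets_eq_imp_space_eq[OF sets_sm]
    by (simp add: emeasure_sphere_measure ennreal_mult_eq_top_iff less_top)
  then interpret finite_measure "sphere_measure :: 'a measure"
    by (rule finite_measureI)
  define B where "B = (\<Prod>\<alpha>\<in>Rp. if k \<alpha> = 0 then 1 else norm \<alpha> powr (2 * k \<alpha>))"
  have "0 \<le> B"
    unfolding B_def by (intro prod_nonneg) auto
  then have "norm (f x) \<le> B" for x
    using omega_k_le[OF k, of x] omega_k_nonneg[of Rp k x]
    by (auto simp: f_def B_def indicator_def)
  then have int: "integrable sphere_measure f"
    by (intro integrable_const_bound[of f B]) auto
  have "integral\<^sup>L sphere_measure f \<noteq> 0"
  proof
    assume "integral\<^sup>L sphere_measure f = 0"
    then have "AE x in sphere_measure. f x = 0"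
      using integral_nonneg_eq_0_iff_AE[OF int] f_nonneg by simp
    then have "emeasure sphere_measure {x. f x \<noteq> 0} = 0"
      using AE_iff_measurable[of "{x. f x \<noteq> 0}" sphere_measure "\<lambda>x. f x = 0"]
        sets_eq_imp_space_eq[OF sets_sm] by (simp add: sets_sm)
    then have "emeasure lborel ({x. sgn x \<in> {x. f x \<noteq> 0}} \<inter> (ball 0 1 - {0})) = 0"
      by (subst (asm) emeasure_sphere_measure) auto
    then have "AE x in lborel. x \<notin> {x. sgn x \<in> {x. f x \<noteq> 0}} \<inter> (ball 0 1 - {0})"
      by (intro AE_not_in null_setsI) auto
    moreover have "AE x in lborel. x \<noteq> (0::'a)"
      by (rule AE_lborel_singleton)
    ultimately have "AE x in lborel. x \<notin> ball (0::'a) 1"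
      using AE_omega_k_sgn_pos[OF fin nz, of k]
    proof eventually_elim
      case (elim x)
      then show ?case by (auto simp: f_def norm_sgn)
    qed
    then have "emeasure lborel (ball (0::'a) 1) = 0"
      by (subst (asm) AE_iff_measurable[of "ball 0 1"]) auto
    then show False
      by (simp add: emeasure_ball unit_ball_vol_pos less_imp_neq[THEN not_sym])
  qed
  moreover have "0 \<le> integral\<^sup>L sphere_measure f"
    using f_nonneg by (intro integral_nonneg_AE) auto
  ultimately show ?thesis
    unfolding d_k_def set_lebesgue_integral_def f_def by linarith
qed

section \<open>Comparison of the integrals\<close>

lemma comparableI:
  assumes "ennreal l * g \<le> f" "f \<le> ennreal u * g" "0 < l" "inverse l \<le> C" "u \<le> C"
  shows "comparable C f g"
proof -
  have "inverse C \<le> inverse (inverse l)"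
    using assms by (intro le_imp_inverse_le) auto
  then have "ennreal (inverse C) * g \<le> ennreal l * g"
    by (intro mult_right_mono ennreal_leI) auto
  moreover have "ennreal u * g \<le> ennreal C * g"
    using assms by (intro mult_right_mono ennreal_leI) auto
  ultimately show ?thesis
    using assms unfolding comparable_def by (meson order_trans)
qed

lemma set_nn_integral_bounds:
  fixes f g :: "'a \<Rightarrow> ennreal"
  assumes A: "A \<in> sets M" and g: "g \<in> borel_measurable M"
  shows "(\<And>z. z \<in> A \<Longrightarrow> c * g z \<le> f z) \<Longrightarrow> c * (\<integral>\<^sup>+z\<in>A. g z \<partial>M) \<le> (\<integral>\<^sup>+z\<in>A. f z \<partial>M)"
    and "(\<And>z. z \<in> A \<Longrightarrow> f z \<le> c * g z) \<Longrightarrow> (\<integral>\<^sup>+z\<in>A. f z \<partial>M) \<le> c * (\<integral>\<^sup>+z\<in>A. g z \<partial>M)"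
proof -
  note [measurable] = A g
  have eq: "c * (\<integral>\<^sup>+z\<in>A. g z \<partial>M) = (\<integral>\<^sup>+z\<in>A. c * g z \<partial>M)"
    by (subst nn_integral_cmult[symmetric]) (auto simp: mult.assoc)
  show "(\<And>z. z \<in> A \<Longrightarrow> c * g z \<le> f z) \<Longrightarrow> c * (\<integral>\<^sup>+z\<in>A. g z \<partial>M) \<le> (\<integral>\<^sup>+z\<in>A. f z \<partial>M)"
    unfolding eq by (intro nn_integral_mono) (auto simp: indicator_def)
  show "(\<And>z. z \<in> A \<Longrightarrow> f z \<le> c * g z) \<Longrightarrow> (\<integral>\<^sup>+z\<in>A. f z \<partial>M) \<le> c * (\<integral>\<^sup>+z\<in>A. g z \<partial>M)"
    unfolding eq by (intro nn_integral_mono) (auto simp: indicator_def)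
qed

lemma one_minus_square_product_bounds:
  fixes u v :: real
  assumes "0 \<le> u" "u < 1" "0 \<le> v" "v < 1"
  shows "0 < (1 - u) * (1 - v)"
    and "(1 - u) * (1 - v) \<le> (1 - u\<^sup>2) * (1 - v\<^sup>2)"
    and "(1 - u\<^sup>2) * (1 - v\<^sup>2) \<le> 4 * ((1 - u) * (1 - v))"
proof -
  show pos: "0 < (1 - u) * (1 - v)" using assms by simp
  have eq: "(1 - u\<^sup>2) * (1 - v\<^sup>2) = ((1 + u) * (1 + v)) * ((1 - u) * (1 - v))"
    by (simp add: power2_eq_square algebra_simps)
  have "1 * 1 \<le> (1 + u) * (1 + v)" "(1 + u) * (1 + v) \<le> 2 * 2"
    using assms by (intro mult_mono; simp)+
  then show "(1 - u) * (1 - v) \<le> (1 - u\<^sup>2) * (1 - v\<^sup>2)"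
    and "(1 - u\<^sup>2) * (1 - v\<^sup>2) \<le> 4 * ((1 - u) * (1 - v))"
    unfolding eq using mult_right_mono[OF _ less_imp_le[OF pos]] by force+
qed

text \<open>The pointwise bounds integrated. The Green function is \<open>I0\<close> for \<open>s = \<gamma> + d/2 - 1\<close> and
  \<open>c = C\<^sub>k\<close>. The conditions on \<open>C\<close> say that \<open>[1/C, C]\<close> contains \<open>[1, 4]\<close>, needed for \<open>I1\<close>
  against \<open>I2\<close>, and \<open>[c min(1,s), c max(1,s)]\<close>, needed for \<open>I0\<close> against \<open>I1\<close>.\<close>

lemma kernel_integrals_comparable:
  fixes M :: "'a::euclidean_space measure"
  assumes M: "sets M = sets borel" and H: "orbit_hull R y \<in> sets M"
    and x: "x \<in> ball 0 1" and y: "y \<in> ball 0 1" and s: "0 < s" and c: "0 < c"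
    and C: "4 \<le> C" "c * max 1 s \<le> C" "inverse (c * min 1 s) \<le> C"
  defines "a \<equiv> \<lambda>z. (norm x)\<^sup>2 + (norm y)\<^sup>2 - 2 * (x \<bullet> z)"
  defines "b \<equiv> \<lambda>z. 1 + (norm x)\<^sup>2 * (norm y)\<^sup>2 - 2 * (x \<bullet> z)"
  defines "P \<equiv> (1 - (norm x)\<^sup>2) * (1 - (norm y)\<^sup>2)"
  defines "D \<equiv> (1 - norm x) * (1 - norm y)"
  defines "I0 \<equiv> ennreal c * (\<integral>\<^sup>+z\<in>orbit_hull R y. (epowr (a z) (- s) - epowr (b z) (- s)) \<partial>M)"
  defines "I1 \<equiv> (\<integral>\<^sup>+z\<in>orbit_hull R y. ennreal P / ennreal (b z * a z powr s) \<partial>M)"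
  defines "I2 \<equiv> (\<integral>\<^sup>+z\<in>orbit_hull R y.
      ennreal D / ennreal ((D + (norm x)\<^sup>2 + (norm y)\<^sup>2 - 2 * (x \<bullet> z)) * a z powr s) \<partial>M)"
  shows "comparable C I0 I1 \<and> comparable C I1 I2"
proof -
  have [measurable_cong]: "sets M = sets borel" by (rule M)
  have b_eq: "b z = a z + P" for z
    by (simp add: a_def b_def P_def algebra_simps)
  have D_eq: "D + (norm x)\<^sup>2 + (norm y)\<^sup>2 - 2 * (x \<bullet> z) = D + a z" for z
    by (simp add: a_def)
  have D: "0 < D" "D \<le> P" "P \<le> 4 * D"
    using one_minus_square_product_bounds[of "norm x" "norm y"] x y by (auto simp: D_def P_def)
  then have P: "0 < P" by simp
  have a: "0 \<le> a z" if "z \<in> orbit_hull R y" for z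
    using orbit_hull_dist_nonneg[OF that] by (simp add: a_def)
  have m1: "(\<lambda>z. ennreal P / ennreal ((a z + P) * a z powr s)) \<in> borel_measurable M"
    unfolding a_def by measurable
  have m2: "(\<lambda>z. ennreal D / ennreal ((D + a z) * a z powr s)) \<in> borel_measurable M"
    unfolding a_def by measurable
  define J where "J = (\<integral>\<^sup>+z\<in>orbit_hull R y. (epowr (a z) (- s) - epowr (a z + P) (- s)) \<partial>M)"
  have I0: "I0 = ennreal c * J"
    by (simp add: I0_def J_def b_eq)
  have "ennreal (min 1 s) * I1 \<le> J" "J \<le> ennreal (max 1 s) * I1"
    unfolding I1_def J_def b_eq
    by (intro set_nn_integral_bounds[OF H m1] epowr_difference_bounds a P s; assumption)+
  then have "ennreal c * (ennreal (min 1 s) * I1) \<le> I0" "I0 \<le> ennreal c * (ennreal (max 1 s) * I1)"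
    unfolding I0 by (intro mult_left_mono; simp)+
  then have "ennreal (c * min 1 s) * I1 \<le> I0" "I0 \<le> ennreal (c * max 1 s) * I1"
    using c by (auto simp: ennreal_mult' mult.assoc)
  then have "comparable C I0 I1"
    using C s c by (intro comparableI[of "c * min 1 s" I1 I0 "c * max 1 s"]) auto
  moreover have "1 * I2 \<le> I1" "I1 \<le> ennreal 4 * I2"
    unfolding I1_def I2_def b_eq D_eq
    using kernel_bounds[OF a D]
    by (intro set_nn_integral_bounds[OF H m2]; simp)+
  then have "comparable C I1 I2"
    using C by (intro comparableI[of 1 I2 I1 4]) auto
  ultimately show ?thesis ..
qed

section \<open>Two-sided bounds for the Green function\<close>

theorem theorem3p2:
  fixes R :: "'a::euclidean_space set" and k :: "'a \<Rightarrow> real"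
  assumes "root_system R" and "multiplicity_function R k"
  shows "\<exists>C>0. \<forall>Rp V \<mu>.
    positive_subsystem R Rp \<longrightarrow>
    2 < real DIM('a) + 2 * gamma_k Rp k \<longrightarrow>
    intertwining_operator Rp k V \<longrightarrow>
    representing_measures R V \<mu> \<longrightarrow>
    (\<forall>x\<in>ball 0 1. \<forall>y\<in>ball 0 1.
      (let I1 = (\<integral>\<^sup>+z\<in>orbit_hull R y.
             ennreal ((1 - (norm x)\<^sup>2) * (1 - (norm y)\<^sup>2)) /
             ennreal ((1 + (norm x)\<^sup>2 * (norm y)\<^sup>2 - 2 * (x \<bullet> z)) *
               ((norm x)\<^sup>2 + (norm y)\<^sup>2 - 2 * (x \<bullet> z)) powr (gamma_k Rp k + real DIM('a) / 2 - 1))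
             \<partial>\<mu> y);
           I2 = (\<integral>\<^sup>+z\<in>orbit_hull R y.
             ennreal ((1 - norm x) * (1 - norm y)) /
             ennreal (((1 - norm x) * (1 - norm y) + (norm x)\<^sup>2 + (norm y)\<^sup>2 - 2 * (x \<bullet> z)) *
               ((norm x)\<^sup>2 + (norm y)\<^sup>2 - 2 * (x \<bullet> z)) powr (gamma_k Rp k + real DIM('a) / 2 - 1))
             \<partial>\<mu> y)
       in comparable C (green_k R Rp k \<mu> x y) I1 \<and> comparable C I1 I2))"
proof -
  define s where "s Rp = gamma_k Rp k + real DIM('a) / 2 - 1" for Rp :: "'a set"
  define Cst where "Cst Rp = max 4 (max (C_k Rp k * max 1 (s Rp)) (inverse (C_k Rp k * min 1 (s Rp))))"
    for Rp
  define C where "C = Max (Cst ` Pow R)"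
  have fin: "finite R" and nz: "0 \<notin> R"
    using assms(1) by (auto simp: root_system_def)
  have k: "\<forall>\<alpha>\<in>R. 0 \<le> k \<alpha>"
    using assms(2) by (auto simp: multiplicity_function_def)
  have Cst_le: "Cst Rp \<le> C" if "Rp \<subseteq> R" for Rp
    unfolding C_def using fin that by (intro Max_ge) auto
  have "4 \<le> C"
    using Cst_le[of "{}"] by (simp add: Cst_def)
  show ?thesis
  proof (intro exI[of _ C] conjI allI impI ballI)
    show "0 < C" using \<open>4 \<le> C\<close> by simp
    fix Rp V \<mu> and x y :: 'a
    assume pos: "positive_subsystem R Rp" and dim: "2 < real DIM('a) + 2 * gamma_k Rp k"
      and \<mu>: "representing_measures R V \<mu>"
      and x: "x \<in> ball 0 1" and y: "y \<in> ball 0 1"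
    have sub: "Rp \<subseteq> R"
      using pos by (auto simp: positive_subsystem_def)
    have M: "sets (\<mu> y) = sets borel" and one: "emeasure (\<mu> y) (orbit_hull R y) = 1"
      using \<mu> by (auto simp: representing_measures_def)
    \<comment> \<open>The hull is measurable because non-measurable sets have measure \<open>0\<close> by convention.\<close>
    have H: "orbit_hull R y \<in> sets (\<mu> y)"
      using one by (intro emeasure_neq_0_sets) simp
    have s: "0 < s Rp"
      using dim by (simp add: s_def)
    have "0 < d_k Rp k"
      using sub fin nz k by (intro d_k_pos) (auto intro: finite_subset)
    then have c: "0 < C_k Rp k"
      using dim by (simp add: C_k_def)
    have exponent: "1 - gamma_k Rp k - real DIM('a) / 2 = - s Rp"
      by (simp add: s_def)
    have "4 \<le> C" "C_k Rp k * max 1 (s Rp) \<le> C" "inverse (C_k Rp k * min 1 (s Rp)) \<le> C"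
      using Cst_le[OF sub] by (auto simp: Cst_def)
    from kernel_integrals_comparable[OF M H x y s c this]
    show "let I1 = (\<integral>\<^sup>+z\<in>orbit_hull R y.
             ennreal ((1 - (norm x)\<^sup>2) * (1 - (norm y)\<^sup>2)) /
             ennreal ((1 + (norm x)\<^sup>2 * (norm y)\<^sup>2 - 2 * (x \<bullet> z)) *
               ((norm x)\<^sup>2 + (norm y)\<^sup>2 - 2 * (x \<bullet> z)) powr (gamma_k Rp k + real DIM('a) / 2 - 1))
             \<partial>\<mu> y);
           I2 = (\<integral>\<^sup>+z\<in>orbit_hull R y.
             ennreal ((1 - norm x) * (1 - norm y)) /
             ennreal (((1 - norm x) * (1 - norm y) + (norm x)\<^sup>2 + (norm y)\<^sup>2 - 2 * (x \<bullet> z)) *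
               ((norm x)\<^sup>2 + (norm y)\<^sup>2 - 2 * (x \<bullet> z)) powr (gamma_k Rp k + real DIM('a) / 2 - 1))
             \<partial>\<mu> y)
       in comparable C (green_k R Rp k \<mu> x y) I1 \<and> comparable C I1 I2"
      unfolding green_k_def Let_def exponent unfolding s_def .
  qed
qed

end
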